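(* Let $\lambda\in\mathbb{R}\setminus\{0\}$, let $r$ be a nonnegative integer and $p$ a nonnegative integer. Then for all real $x$, $$\sum_{n=0}^{\infty}\Big((r)_{p,\lambda}+(1+r)_{p,\lambda}+\cdots+(n+r)_{p,\lambda}\Big)\frac{x^{n}}{n!}=e^{x}\sum_{k=0}^{p}{p+r \brace k+r}_{r,\lambda}\bigg(x^{k}+\frac{x^{k+1}}{k+1}\bigg).$$
   Context: For $\lambda\neq0$, $(x)_{0,\lambda}=1$ and $(x)_{n,\lambda}=x(x-\lambda)\cdots(x-(n-1)\lambda)$ for $n\ge1$; $(x)_k=x(x-1)\cdots(x-k+1)$ is the ordinary falling factorial. For a nonnegative integer $r$, the degenerate $r$-Stirling numbers of the second kind ${n+r \brace k+r}_{r,\lambda}$ ($0\le k\le n$) are defined by $(x+r)_{n,\lambda}=\sum_{k=0}^{n}{n+r \brace k+r}_{r,\lambda}(x)_{k}$ for all $n\ge0$. *)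

theory Defs
  imports "HOL-Analysis.Analysis"
begin

definition degen_ffact :: "real \<Rightarrow> real \<Rightarrow> nat \<Rightarrow> real" where
  "degen_ffact l x n = (\<Prod>i<n. x - real i * l)"

definition ffact :: "real \<Rightarrow> nat \<Rightarrow> real" where
  "ffact x k = (\<Prod>i<k. x - real i)"

text \<open>
  The value \<open>degen_r_stirling2 l r n k\<close> stands for the number with upper entry \<open>n + r\<close>, lower entry
  \<open>k + r\<close> and parameters \<open>r, l\<close>: both arguments are shifted by \<open>r\<close>. The numbers are given only
  through the connection formula; requiring them to vanish for \<open>k > n\<close> makes the coefficient
  function unique as a total function, see \<open>degen_r_stirling2_ex1\<close> below.
\<close>

definition degen_r_stirling2 :: "real \<Rightarrow> nat \<Rightarrow> nat \<Rightarrow> nat \<Rightarrow> real" where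
  "degen_r_stirling2 l r n =
     (THE c. (\<forall>x. degen_ffact l (x + real r) n = (\<Sum>k\<le>n. c k * ffact x k)) \<and> (\<forall>k>n. c k = 0))"

lemma ffact_Suc: "ffact x (Suc k) = ffact x k * (x - real k)"
  by (simp add: ffact_def)

lemma degen_ffact_Suc: "degen_ffact l x (Suc n) = degen_ffact l x n * (x - real n * l)"
  by (simp add: degen_ffact_def)

lemma ffact_of_nat_eq_0: "m < k \<Longrightarrow> ffact (real m) k = 0"
  by (auto simp: ffact_def)

lemma ffact_of_nat_self: "ffact (real m) m \<noteq> 0"
  by (auto simp: ffact_def)

lemma ffact_coeffs_unique:
  assumes "\<And>x. (\<Sum>k\<le>n. c k * ffact x k) = (\<Sum>k\<le>n. d k * ffact x k)"
    and "m \<le> n"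
  shows "c m = d m"
  using assms(2)
proof (induction m rule: less_induct)
  case (less m)
  have trunc: "(\<Sum>k\<le>n. e k * ffact (real m) k)
      = (\<Sum>k<m. e k * ffact (real m) k) + e m * ffact (real m) m" for e
  proof -
    have "(\<Sum>k\<le>n. e k * ffact (real m) k) = (\<Sum>k\<le>m. e k * ffact (real m) k)"
      by (rule sum.mono_neutral_right) (use less.prems in \<open>auto simp: ffact_of_nat_eq_0\<close>)
    then show ?thesis
      by (simp add: lessThan_Suc_atMost [symmetric])
  qed
  have "(\<Sum>k<m. c k * ffact (real m) k) = (\<Sum>k<m. d k * ffact (real m) k)"
    by (rule sum.cong) (use less in auto)
  with assms(1)[of "real m"] have "c m * ffact (real m) m = d m * ffact (real m) m"
    by (simp add: trunc)
  then show ?case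
    by (simp add: ffact_of_nat_self)
qed

lemma degen_ffact_coeffs_exist:
  "\<exists>c. (\<forall>x. degen_ffact l (x + real r) n = (\<Sum>k\<le>n. c k * ffact x k)) \<and> (\<forall>k>n. c k = 0)"
proof (induction n)
  case 0
  show ?case
    by (rule exI[of _ "\<lambda>k. if k = 0 then 1 else 0"]) (simp add: degen_ffact_def ffact_def)
next
  case (Suc n)
  then obtain c where c: "\<And>x. degen_ffact l (x + real r) n = (\<Sum>k\<le>n. c k * ffact x k)"
    and c0: "\<And>k. k > n \<Longrightarrow> c k = 0"
    by blast
  define a where "a k = (real k + real r - real n * l) * c k" for k
  define d where "d k = (case k of 0 \<Rightarrow> 0 | Suc j \<Rightarrow> c j) + a k" for k
  have "degen_ffact l (x + real r) (Suc n) = (\<Sum>k\<le>Suc n. d k * ffact x k)" for x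
  proof -
    have "degen_ffact l (x + real r) (Suc n)
        = (\<Sum>k\<le>n. c k * ffact x k * (x + real r - real n * l))"
      by (simp add: degen_ffact_Suc c sum_distrib_right)
    also have "\<dots> = (\<Sum>k\<le>n. c k * ffact x (Suc k) + a k * ffact x k)"
      by (rule sum.cong) (simp_all add: ffact_Suc a_def algebra_simps)
    also have "\<dots> = (\<Sum>k\<le>n. c k * ffact x (Suc k)) + (\<Sum>k\<le>n. a k * ffact x k)"
      by (rule sum.distrib)
    also have "(\<Sum>k\<le>n. c k * ffact x (Suc k))
        = (\<Sum>k\<le>Suc n. (case k of 0 \<Rightarrow> 0 | Suc j \<Rightarrow> c j) * ffact x k)"
      by (simp add: sum.atMost_Suc_shift del: sum.atMost_Suc)
    also have "(\<Sum>k\<le>n. a k * ffact x k) = (\<Sum>k\<le>Suc n. a k * ffact x k)"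
      by (simp add: a_def c0)
    finally show ?thesis
      by (simp add: d_def algebra_simps sum.distrib del: sum.atMost_Suc)
  qed
  moreover have "d k = 0" if "k > Suc n" for k
    using that by (cases k) (auto simp: d_def a_def c0)
  ultimately show ?case
    by blast
qed

lemma degen_r_stirling2_ex1:
  "\<exists>!c. (\<forall>x. degen_ffact l (x + real r) n = (\<Sum>k\<le>n. c k * ffact x k)) \<and> (\<forall>k>n. c k = 0)"
proof (rule ex_ex1I)
  fix c d
  assume c: "(\<forall>x. degen_ffact l (x + real r) n = (\<Sum>k\<le>n. c k * ffact x k)) \<and> (\<forall>k>n. c k = 0)"
    and d: "(\<forall>x. degen_ffact l (x + real r) n = (\<Sum>k\<le>n. d k * ffact x k)) \<and> (\<forall>k>n. d k = 0)"
  show "c = d"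
  proof
    fix k
    show "c k = d k"
    proof (cases "k \<le> n")
      case True
      show ?thesis
        by (rule ffact_coeffs_unique[OF _ True]) (use c d in metis)
    next
      case False
      with c d show ?thesis
        by simp
    qed
  qed
qed (rule degen_ffact_coeffs_exist)

lemma degen_r_stirling2_connection:
  "degen_ffact l (x + real r) n = (\<Sum>k\<le>n. degen_r_stirling2 l r n k * ffact x k)"
  using theI'[OF degen_r_stirling2_ex1[of l r n]] unfolding degen_r_stirling2_def by blast

lemma degen_r_stirling2_eq_0: "k > n \<Longrightarrow> degen_r_stirling2 l r n k = 0"
  using theI'[OF degen_r_stirling2_ex1[of l r n]] unfolding degen_r_stirling2_def by blast

end

theory Submission
  imports Defs
begin

text \<open>
  Expanding \<open>(j + r)\<close> to the degenerate falling power \<open>p\<close> in ordinary falling factorials of \<open>j\<close>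
  reduces everything to two facts about the latter: summing \<open>(j)\<^sub>k\<close> over \<open>j \<le> n\<close> gives
  \<open>(n + 1)\<^sub>k\<^sub>+\<^sub>1 / (k + 1) = (n)\<^sub>k + (n)\<^sub>k\<^sub>+\<^sub>1 / (k + 1)\<close>, and the exponential generating function of
  \<open>(n)\<^sub>k\<close> is \<open>x\<^sup>k e\<^sup>x\<close>.
\<close>

lemma sum_ffact:
  "(\<Sum>j\<le>n. ffact (real j) k) = ffact (real n) k + ffact (real n) (Suc k) / real (Suc k)"
proof (induction n)
  case 0
  show ?case
    by (cases k) (auto simp: ffact_def prod.lessThan_Suc_shift)
next
  case (Suc n)
  \<comment> \<open>Splitting off the first factor rather than the last merges both terms of the
    induction hypothesis into one.\<close>
  have shift: "ffact (real (Suc n)) (Suc k) = (real n + 1) * ffact (real n) k"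
    by (simp add: ffact_def prod.lessThan_Suc_shift del: prod.lessThan_Suc)
  have "ffact (real n) k + ffact (real n) (Suc k) / real (Suc k)
      = ffact (real (Suc n)) (Suc k) / real (Suc k)"
    unfolding shift by (simp add: ffact_Suc field_simps)
  with Suc.IH show ?case
    by simp
qed

lemma ffact_mult_fact: "ffact (real (m + k)) k * fact m = fact (m + k)"
proof (induction k arbitrary: m)
  case 0
  show ?case
    by (simp add: ffact_def)
next
  case (Suc k)
  \<comment> \<open>The last factor is \<open>m + 1\<close>; the factorial absorbs it, hence the
    induction hypothesis at \<open>Suc m\<close>.\<close>
  have "ffact (real (m + Suc k)) (Suc k) * fact m = ffact (real (Suc m + k)) k * fact (Suc m)"
    by (simp add: ffact_Suc algebra_simps)
  then show ?case
    using Suc.IH[of "Suc m"] by simp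
qed

text \<open>This is \<open>x ^ k\<close> times the exponential series, reindexed by
  \<open>n = m + k\<close>.\<close>

lemma sums_ffact_exp: "(\<lambda>n. ffact (real n) k * (x ^ n / fact n)) sums (x ^ k * exp x)"
proof -
  have "(\<lambda>m. x ^ k * (x ^ m / fact m)) sums (x ^ k * exp x)"
    using exp_converges[of x] by (intro sums_mult) (simp add: field_simps)
  also have "(\<lambda>m. x ^ k * (x ^ m / fact m))
      = (\<lambda>m. ffact (real (m + k)) k * (x ^ (m + k) / fact (m + k)))"
  proof
    fix m
    have "ffact (real (m + k)) k \<noteq> 0"
      using ffact_mult_fact[of m k] by (metis fact_nonzero mult_zero_left)
    then show "x ^ k * (x ^ m / fact m) = ffact (real (m + k)) k * (x ^ (m + k) / fact (m + k))"
      unfolding ffact_mult_fact[of m k, symmetric] by (simp add: power_add)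
  qed
  finally show ?thesis
    \<comment> \<open>The terms with \<open>n < k\<close> vanish, so the index shift keeps the
      sum.\<close>
    by (subst (asm) sums_zero_iff_shift) (simp_all add: ffact_of_nat_eq_0)
qed

theorem theorem4:
  fixes l x :: real and r p :: nat
  assumes "l \<noteq> 0"
  shows "(\<lambda>n. (\<Sum>j\<le>n. degen_ffact l (real j + real r) p) * (x ^ n / fact n)) sums
    (exp x * (\<Sum>k\<le>p. degen_r_stirling2 l r p k * (x ^ k + x ^ (k + 1) / real (k + 1))))"
proof -
  let ?S = "degen_r_stirling2 l r p"
  let ?t = "\<lambda>k n. ffact (real n) k * (x ^ n / fact n)"
  have "(\<lambda>n. \<Sum>k\<le>p. ?S k * (?t k n + ?t (Suc k) n / real (Suc k))) sums
      (\<Sum>k\<le>p. ?S k * (x ^ k * exp x + x ^ Suc k * exp x / real (Suc k)))"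
    by (intro sums_sum sums_mult sums_add sums_divide sums_ffact_exp)
  moreover have "(\<Sum>j\<le>n. degen_ffact l (real j + real r) p) * (x ^ n / fact n)
      = (\<Sum>k\<le>p. ?S k * (?t k n + ?t (Suc k) n / real (Suc k)))" for n
  proof -
    \<comment> \<open>The coefficients \<open>?S k\<close> do not depend on \<open>j\<close>, so the
      inner sum is one that \<open>sum_ffact\<close> evaluates.\<close>
    have "(\<Sum>j\<le>n. degen_ffact l (real j + real r) p) = (\<Sum>k\<le>p. ?S k * (\<Sum>j\<le>n. ffact (real j) k))"
      unfolding degen_r_stirling2_connection sum_distrib_left by (rule sum.swap)
    then show ?thesis
      by (simp only: sum_ffact sum_distrib_right distrib_right mult.assoc times_divide_eq_left)
  qed
  moreover have "exp x * (\<Sum>k\<le>p. ?S k * (x ^ k + x ^ (k + 1) / real (k + 1)))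
      = (\<Sum>k\<le>p. ?S k * (x ^ k * exp x + x ^ Suc k * exp x / real (Suc k)))"
    unfolding sum_distrib_left by (rule sum.cong) (simp_all add: algebra_simps)
  ultimately show ?thesis
    by simp
qed

end
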